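(* Let $m\ge 2$ be an integer, let $\mathcal I$ be any instance $\mathcal I_r$ of $m$-LIT $(2m-1)$-SAT obtained by the recursive construction described in the context (with any choices of the splittings), and let $G=\widetilde G(\mathcal I)$ be its augmented independence graph. Then $G$ satisfies $\Delta(G)=3m$ and $\chi(G)=\omega(G)=2m$, but $$\operatorname{vs}_\chi(G)=\operatorname{vs}_\omega(G)<\operatorname{ivs}_\omega(G)\le\operatorname{ivs}_\chi(G).$$
   Context: Graphs are finite and simple; $\Delta(G)$, $\chi(G)$, $\omega(G)$ denote maximum degree, chromatic number and clique number. $\operatorname{vs}_\chi(G)$ (respectively $\operatorname{vs}_\omega(G)$) is the minimum size of a set $S\subseteq V(G)$ with $\chi(G\setminus S)<\chi(G)$ (respectively $\omega(G\setminus S)<\omega(G)$). $\operatorname{ivs}_\chi(G)$ and $\operatorname{ivs}_\omega(G)$ are defined in the same way with $S$ required to be an independent set; $\operatorname{ivs}_\omega(G)$ exists whenever $\omega(G)=\chi(G)$. A SAT instance is a finite list of clauses, each clause being a finite list (disjunction) of literals (variables or negated variables), in which the same literal may be repeated. For positive integers $p,q$, $p$-LIT $q$-SAT is the class of SAT instances in which each clause contains exactly $q$ literals (counted with multiplicity) and each literal appears at most $p$ times in total (counted with multiplicity over all clauses). The independence graph $G(\mathcal I)$ of an instance $\mathcal I$ has one vertex for each literal occurrence in each clause, two vertices being adjacent if they are in the same clause or correspond to complementary literals. The augmented independence graph $\widetilde G(\mathcal I)$ is obtained from $G(\mathcal I)$ by adding, for each clause, two extra vertices, each adjacent to all vertices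 of that clause and to nothing else (in particular not to each other). Construction. Given $m\ge2$, let $r=\lceil\log_2 m\rceil$. The instance $\mathcal I_0$ consists of two clauses, one consisting of $2m-2^r$ copies of a literal $a$ and the other of $2m-2^r$ copies of $\overline a$, where $a$ is a variable. For $i=1,\ldots,r$, $\mathcal I_i$ is obtained from $\mathcal I_{i-1}$ as follows: for each clause $x$ of $\mathcal I_{i-1}$ (which has $2m-2^{r-i+1}$ literals), take a new variable $b_x$, split the literals of $x$ arbitrarily into two groups of $m-2^{r-i}$ literals, and replace $x$ by two clauses $x^+$ and $x^-$, where $x^+$ consists of $m$ copies of $b_x$ together with the first group and $x^-$ consists of $m$ copies of $\overline{b_x}$ together with the second group. Then $\mathcal I_r$ is an instance of $m$-LIT $(2m-1)$-SAT. *)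

theory Defs
  imports Complex_Main "HOL-Library.Ramsey" "HOL-Library.Multiset"
begin

section \<open>Finite simple graphs\<close>

record 'a ugraph =
  verts :: "'a set"
  edges :: "'a set set"

definition simple_graph :: "'a ugraph \<Rightarrow> bool" where
  "simple_graph G \<longleftrightarrow> finite (verts G) \<and> (\<forall>e\<in>edges G. e \<subseteq> verts G \<and> card e = 2)"

definition degree :: "'a ugraph \<Rightarrow> 'a \<Rightarrow> nat" where
  "degree G v = card {w \<in> verts G. {v, w} \<in> edges G}"

definition max_degree :: "'a ugraph \<Rightarrow> nat" where
  "max_degree G = Max (degree G ` verts G)"

definition proper_coloring :: "'a ugraph \<Rightarrow> nat \<Rightarrow> ('a \<Rightarrow> nat) \<Rightarrow> bool" where
  "proper_coloring G k c \<longleftrightarrow>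
     (\<forall>v\<in>verts G. c v < k) \<and>
     (\<forall>v\<in>verts G. \<forall>w\<in>verts G. {v, w} \<in> edges G \<longrightarrow> c v \<noteq> c w)"

definition chromatic_number :: "'a ugraph \<Rightarrow> nat" where
  "chromatic_number G = (LEAST k. \<exists>c. proper_coloring G k c)"

definition clique_number :: "'a ugraph \<Rightarrow> nat" where
  "clique_number G = Max {card K |K. K \<subseteq> verts G \<and> clique K (edges G)}"

definition delete_verts :: "'a ugraph \<Rightarrow> 'a set \<Rightarrow> 'a ugraph" where
  "delete_verts G S = \<lparr>verts = verts G - S, edges = {e \<in> edges G. e \<inter> S = {}}\<rparr>"

definition vs_chi :: "'a ugraph \<Rightarrow> nat" where
  "vs_chi G = (LEAST s. \<exists>S \<subseteq> verts G. card S = s \<and>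
     chromatic_number (delete_verts G S) < chromatic_number G)"

definition vs_omega :: "'a ugraph \<Rightarrow> nat" where
  "vs_omega G = (LEAST s. \<exists>S \<subseteq> verts G. card S = s \<and>
     clique_number (delete_verts G S) < clique_number G)"

text \<open>
  The minimum over independent sets need not exist for every graph (for \<open>ivs_omega\<close>) and is
  then an unspecified number; the lemmas \<open>ivs_chi_exists\<close> and \<open>ivs_omega_exists\<close> below show
  that the minima are attained whenever the graph is nonempty and, for \<open>ivs_omega\<close>, its
  chromatic number and clique number agree.
\<close>

definition ivs_chi :: "'a ugraph \<Rightarrow> nat" where
  "ivs_chi G = (LEAST s. \<exists>S \<subseteq> verts G. indep S (edges G) \<and> card S = s \<and>
     chromatic_number (delete_verts G S) < chromatic_number G)"

definition ivs_omega :: "'a ugraph \<Rightarrow> nat" where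
  "ivs_omega G = (LEAST s. \<exists>S \<subseteq> verts G. indep S (edges G) \<and> card S = s \<and>
     clique_number (delete_verts G S) < clique_number G)"


subsection \<open>The minima exist\<close>

lemma simple_graph_delete_verts:
  "simple_graph G \<Longrightarrow> simple_graph (delete_verts G S)"
  unfolding simple_graph_def delete_verts_def by auto

lemma proper_coloring_exists:
  assumes "simple_graph G"
  shows "\<exists>k c. proper_coloring G k c"
proof -
  have fin: "finite (verts G)" using assms by (simp add: simple_graph_def)
  then obtain c where c: "bij_betw c (verts G) {0..<card (verts G)}"
    using ex_bij_betw_finite_nat by blast
  have "proper_coloring G (card (verts G)) c"
    unfolding proper_coloring_def
  proof (intro conjI ballI impI)
    fix v assume "v \<in> verts G"
    then show "c v < card (verts G)" using c by (auto simp: bij_betw_def)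
  next
    fix v w assume *: "v \<in> verts G" "w \<in> verts G" "{v, w} \<in> edges G"
    then have "v \<noteq> w" using assms by (auto simp: simple_graph_def)
    then show "c v \<noteq> c w" using c * by (auto simp: bij_betw_def inj_on_def)
  qed
  then show ?thesis by blast
qed

lemma chromatic_number_coloring:
  assumes "simple_graph G"
  obtains c where "proper_coloring G (chromatic_number G) c"
  using LeastI_ex[OF proper_coloring_exists[OF assms]] unfolding chromatic_number_def by blast

lemma chromatic_number_le: "proper_coloring G k c \<Longrightarrow> chromatic_number G \<le> k"
  unfolding chromatic_number_def by (rule Least_le) blast

lemma ivs_chi_exists:
  assumes G: "simple_graph G" and ne: "verts G \<noteq> {}"
  shows "\<exists>S \<subseteq> verts G. indep S (edges G) \<and>
           chromatic_number (delete_verts G S) < chromatic_number G"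
proof -
  obtain c where c: "proper_coloring G (chromatic_number G) c"
    using chromatic_number_coloring[OF G] .
  define k where "k = chromatic_number G - 1"
  have lt: "c v < chromatic_number G" if "v \<in> verts G" for v
    using c that by (simp add: proper_coloring_def)
  have ne': "c v \<noteq> c w" if "v \<in> verts G" "w \<in> verts G" "{v, w} \<in> edges G" for v w
    using c that unfolding proper_coloring_def by blast
  have k: "chromatic_number G = Suc k"
    using lt ne unfolding k_def by (metis Suc_pred' all_not_in_conv gr_zeroI not_less_zero)
  define S where "S = {v \<in> verts G. c v = k}"
  have "c v < k" if "v \<in> verts G" "v \<notin> S" for v
    using lt[OF that(1)] that unfolding k S_def by auto
  then have "proper_coloring (delete_verts G S) k c"
    using ne' unfolding proper_coloring_def delete_verts_def by simp
  then have "chromatic_number (delete_verts G S) < chromatic_number G"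
    unfolding k using chromatic_number_le less_Suc_eq_le by blast
  moreover have "indep S (edges G)"
    using ne' unfolding indep_def S_def by force
  moreover have "S \<subseteq> verts G" unfolding S_def by blast
  ultimately show ?thesis by blast
qed

lemma finite_clique_cards:
  assumes "simple_graph G"
  shows "finite {card K |K. K \<subseteq> verts G \<and> clique K (edges G)}"
proof -
  have "{card K |K. K \<subseteq> verts G \<and> clique K (edges G)} \<subseteq> card ` Pow (verts G)" by auto
  then show ?thesis using assms finite_subset by (fastforce simp: simple_graph_def)
qed

lemma clique_number_le_chromatic_number:
  assumes G: "simple_graph G"
  shows "clique_number G \<le> chromatic_number G"
proof -
  obtain c where c: "proper_coloring G (chromatic_number G) c"
    using chromatic_number_coloring[OF G] .
  have "card K \<le> chromatic_number G" if K: "K \<subseteq> verts G" "clique K (edges G)" for K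
  proof -
    have "inj_on c K"
      using c K unfolding inj_on_def clique_def proper_coloring_def by blast
    moreover have "c ` K \<subseteq> {..<chromatic_number G}"
      using c K unfolding proper_coloring_def by auto
    ultimately show ?thesis
      using card_inj_on_le[of c K "{..<chromatic_number G}"] by simp
  qed
  moreover have "{card K |K. K \<subseteq> verts G \<and> clique K (edges G)} \<noteq> {}"
    by (auto simp: clique_def intro!: exI[of _ "{}"])
  ultimately show ?thesis
    unfolding clique_number_def using finite_clique_cards[OF G]
    by (subst Max_le_iff) auto
qed

lemma ivs_omega_exists:
  assumes G: "simple_graph G" and ne: "verts G \<noteq> {}"
    and eq: "clique_number G = chromatic_number G"
  shows "\<exists>S \<subseteq> verts G. indep S (edges G) \<and>
           clique_number (delete_verts G S) < clique_number G"
proof -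
  obtain S where "S \<subseteq> verts G" "indep S (edges G)"
      "chromatic_number (delete_verts G S) < chromatic_number G"
    using ivs_chi_exists[OF G ne] by blast
  then show ?thesis
    using clique_number_le_chromatic_number[OF simple_graph_delete_verts[OF G, of S]] eq
    by (intro exI[of _ S]) simp
qed


section \<open>SAT instances\<close>

datatype 'v literal = Pos 'v | Neg 'v

fun var :: "'v literal \<Rightarrow> 'v" where
  "var (Pos v) = v"
| "var (Neg v) = v"

fun compl :: "'v literal \<Rightarrow> 'v literal" where
  "compl (Pos v) = Neg v"
| "compl (Neg v) = Pos v"

type_synonym 'v clause = "'v literal list"
type_synonym 'v inst = "'v clause list"

definition inst_vars :: "'v inst \<Rightarrow> 'v set" where
  "inst_vars I = var ` set (concat I)"

definition lit_sat :: "nat \<Rightarrow> nat \<Rightarrow> 'v inst \<Rightarrow> bool" where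
  "lit_sat p q I \<longleftrightarrow> (\<forall>C\<in>set I. length C = q) \<and> (\<forall>l. count_list (concat I) l \<le> p)"

text \<open>The pair \<open>(i, j)\<close> stands for the occurrence of a literal at position \<open>j\<close> of clause \<open>i\<close>.\<close>

definition lit_at :: "'v inst \<Rightarrow> nat \<times> nat \<Rightarrow> 'v literal" where
  "lit_at I u = I ! fst u ! snd u"

definition indep_graph :: "'v inst \<Rightarrow> (nat \<times> nat) ugraph" where
  "indep_graph I =
     (let V = {(i, j). i < length I \<and> j < length (I ! i)} in
      \<lparr>verts = V,
       edges = {{u, v} |u v. u \<in> V \<and> v \<in> V \<and> u \<noteq> v \<and>
                  (fst u = fst v \<or> lit_at I u = compl (lit_at I v))}\<rparr>)"

datatype aug_vertex = Occ "nat \<times> nat" | Extra nat bool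

definition aug_indep_graph :: "'v inst \<Rightarrow> aug_vertex ugraph" where
  "aug_indep_graph I =
     (let G = indep_graph I in
      \<lparr>verts = Occ ` verts G \<union> {Extra i s |i s. i < length I},
       edges = (`) Occ ` edges G \<union> {{Occ u, Extra (fst u) s} |u s. u \<in> verts G}\<rparr>)"

lemma simple_graph_indep_graph: "simple_graph (indep_graph I)"
proof -
  have "{(i, j). i < length I \<and> j < length (I ! i)} =
          (SIGMA i:{..<length I}. {..<length (I ! i)})" by auto
  then have "finite {(i, j). i < length I \<and> j < length (I ! i)}" by simp
  then show ?thesis
    by (auto simp: simple_graph_def indep_graph_def Let_def card_insert_if)
qed

lemma simple_graph_aug_indep_graph: "simple_graph (aug_indep_graph I)"
proof -
  have G: "finite (verts (indep_graph I))"
    "\<And>e. e \<in> edges (indep_graph I) \<Longrightarrow> e \<subseteq> verts (indep_graph I) \<and> card e = 2"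
    using simple_graph_indep_graph[of I] by (auto simp: simple_graph_def)
  have "{Extra i s |i s. i < length I} = (\<lambda>(i, s). Extra i s) ` ({..<length I} \<times> UNIV)"
    by auto
  then have "finite {Extra i s |i s. i < length I}" by simp
  moreover have "card (Occ ` e) = card e" for e :: "(nat \<times> nat) set"
    by (simp add: card_image inj_on_def)
  moreover have "fst u < length I" if "u \<in> verts (indep_graph I)" for u
    using that by (auto simp: indep_graph_def Let_def)
  ultimately show ?thesis
    using G by (fastforce simp: simple_graph_def aug_indep_graph_def Let_def)
qed


section \<open>The recursive construction\<close>

text \<open>
  \<open>split_step m k I I'\<close>: clause number \<open>j\<close> of \<open>I\<close> is split (as a multiset, the order of the
  literals playing no role) into \<open>g j\<close> and \<open>h j\<close>, both of size \<open>k\<close>, and \<open>b j\<close> is its new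
  variable.
\<close>

definition split_step :: "nat \<Rightarrow> nat \<Rightarrow> 'v inst \<Rightarrow> 'v inst \<Rightarrow> bool" where
  "split_step m k I I' \<longleftrightarrow>
     (\<exists>b g h.
        inj_on b {..<length I} \<and>
        (\<forall>j<length I. b j \<notin> inst_vars I \<and>
           mset (g j) + mset (h j) = mset (I ! j) \<and>
           length (g j) = k \<and> length (h j) = k) \<and>
        I' = concat (map (\<lambda>j. [replicate m (Pos (b j)) @ g j,
                               replicate m (Neg (b j)) @ h j]) [0..<length I]))"

inductive construction_stage :: "nat \<Rightarrow> nat \<Rightarrow> nat \<Rightarrow> 'v inst \<Rightarrow> bool"
  for m r :: nat where
  base: "construction_stage m r 0
           [replicate (2 * m - 2 ^ r) (Pos a), replicate (2 * m - 2 ^ r) (Neg a)]"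
| step: "construction_stage m r (Suc i) I'"
    if "construction_stage m r i I" "i < r" "split_step m (m - 2 ^ (r - Suc i)) I I'"

definition constructed_instance :: "nat \<Rightarrow> 'v inst \<Rightarrow> bool" where
  "constructed_instance m I \<longleftrightarrow>
     (let r = nat \<lceil>log 2 (real m)\<rceil> in construction_stage m r r I)"

text \<open>
  By \<open>rounds_bound\<close> the truncated subtractions above never truncate, and the construction
  yields instances of \<open>m\<close>-LIT \<open>(2m - 1)\<close>-SAT.
\<close>

lemma rounds_bound:
  assumes "m \<ge> 2"
  shows "m \<le> 2 ^ nat \<lceil>log 2 (real m)\<rceil>" and "2 ^ nat \<lceil>log 2 (real m)\<rceil> < 2 * m"
proof -
  let ?r = "nat \<lceil>log 2 (real m)\<rceil>"
  have "0 \<le> log 2 (real m)" using assms by simp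
  then have r: "real ?r < log 2 (real m) + 1" "log 2 (real m) \<le> real ?r" by linarith+
  have "real m = 2 powr log 2 (real m)"
    using powr_log_cancel[of 2 "real m"] assms by linarith
  also have "\<dots> \<le> 2 powr real ?r" using r(2) by simp
  also have "\<dots> = real (2 ^ ?r)" by (simp add: powr_realpow)
  finally show "m \<le> 2 ^ ?r" by (simp only: of_nat_le_iff)
  have "2 powr real ?r < 2 powr (log 2 (real m) + 1)" using r(1) by simp
  also have "\<dots> = real (2 * m)" using assms by (simp add: powr_add)
  finally have "real (2 ^ ?r) < real (2 * m)" by (simp add: powr_realpow)
  then show "2 ^ ?r < 2 * m" by (simp only: of_nat_less_iff)
qed

lemma count_list_concat_map_upt:
  "count_list (concat (map f [0..<n])) l = (\<Sum>j<n. count_list (f j) l)"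
  by (induction n) simp_all

lemma count_list_replicate: "count_list (replicate n x) y = (if x = y then n else 0)"
  by (induction n) auto

lemma concat_concat_pairs:
  "concat (concat (map (\<lambda>j. [f j, g j]) xs)) = concat (map (\<lambda>j. f j @ g j) xs)"
  by (induction xs) simp_all

lemma split_step_count:
  assumes "split_step m k I I'" and old: "\<And>l. count_list (concat I) l \<le> m"
  shows "count_list (concat I') l \<le> m"
proof -
  obtain b g h where b: "inj_on b {..<length I}"
    and j: "\<And>j. j < length I \<Longrightarrow> b j \<notin> inst_vars I"
      "\<And>j. j < length I \<Longrightarrow> mset (g j) + mset (h j) = mset (I ! j)"
    and I': "I' = concat (map (\<lambda>j. [replicate m (Pos (b j)) @ g j,
                                     replicate m (Neg (b j)) @ h j]) [0..<length I])"
    using assms(1) unfolding split_step_def by blast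
  have split: "count_list (g j) l + count_list (h j) l = count_list (I ! j) l"
    if "j < length I" for j
    using arg_cong[OF j(2)[OF that], of "\<lambda>M. count M l"] by (simp add: count_mset)
  let ?N = "{j \<in> {..<length I}. b j = var l}"
  have fresh: "(Pos (b j) = l \<longrightarrow> b j = var l) \<and> (Neg (b j) = l \<longrightarrow> b j = var l) \<and>
      \<not> (Pos (b j) = l \<and> Neg (b j) = l)" for j
    by auto
  have "concat I' = concat (map (\<lambda>j. replicate m (Pos (b j)) @ g j @
                                    replicate m (Neg (b j)) @ h j) [0..<length I])"
    unfolding I' by (simp add: concat_concat_pairs)
  then have "count_list (concat I') l =
      (\<Sum>j<length I. (if Pos (b j) = l then m else 0) + (if Neg (b j) = l then m else 0) +
        count_list (I ! j) l)"
    by (auto simp: count_list_concat_map_upt count_list_replicate split[symmetric]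
        intro!: sum.cong)
  also have "\<dots> \<le> (\<Sum>j<length I. (if b j = var l then m else 0) + count_list (I ! j) l)"
    using fresh by (intro sum_mono) auto
  also have "\<dots> = m * card ?N + (\<Sum>j<length I. count_list (I ! j) l)"
    by (simp add: sum.distrib sum.If_cases Int_def)
  also have "(\<Sum>j<length I. count_list (I ! j) l) = count_list (concat I) l"
    using count_list_concat_map_upt[of "(!) I" "length I" l] by (simp add: map_nth)
  finally have le: "count_list (concat I') l \<le> m * card ?N + count_list (concat I) l" .
  show ?thesis
  proof (cases "?N = {}")
    case True
    with le old[of l] show ?thesis by (simp only: True card.empty)
  next
    case False
    then obtain j0 where j0: "j0 < length I" "b j0 = var l" by auto
    then have "?N = {j0}" using b by (auto simp: inj_on_def)
    moreover have "l \<notin> set (concat I)"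
      using j(1)[OF j0(1)] j0(2) unfolding inst_vars_def by blast
    then have "count_list (concat I) l = 0" by (simp add: count_list_0_iff)
    ultimately show ?thesis using le by simp
  qed
qed

lemma construction_stage_lit_sat:
  assumes "construction_stage m r i I" and r: "m \<le> 2 ^ r" "2 ^ r < 2 * m"
  shows "lit_sat m (2 * m - 2 ^ (r - i)) I"
  using assms(1)
proof (induction rule: construction_stage.induct)
  case (base a)
  then show ?case using r by (auto simp: lit_sat_def count_list_replicate)
next
  case (step i I I')
  have "(2::nat) ^ (r - Suc i) \<le> 2 ^ (r - 1)" by (simp add: power_increasing)
  moreover have "2 * 2 ^ (r - 1) < 2 * m"
    using r step.hyps by (cases r) auto
  ultimately have "2 ^ (r - Suc i) \<le> m" by linarith
  then have "m + (m - 2 ^ (r - Suc i)) = 2 * m - 2 ^ (r - Suc i)" by simp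
  then have "length C = 2 * m - 2 ^ (r - Suc i)" if "C \<in> set I'" for C
    using step.hyps(3) that unfolding split_step_def by auto
  moreover have "count_list (concat I') l \<le> m" for l
    using split_step_count[OF step.hyps(3)] step.IH by (simp add: lit_sat_def)
  ultimately show ?case by (simp add: lit_sat_def)
qed

lemma constructed_instance_lit_sat:
  assumes "m \<ge> 2" "constructed_instance m I"
  shows "lit_sat m (2 * m - 1) I"
  using construction_stage_lit_sat[OF _ rounds_bound[OF assms(1)]] assms(2)
  unfolding constructed_instance_def Let_def by fastforce

lemma constructed_instance_exists:
  assumes inf: "infinite (UNIV :: 'v set)" and m: "m \<ge> 2"
  shows "\<exists>I :: 'v inst. constructed_instance m I"
proof -
  define r where "r = nat \<lceil>log 2 (real m)\<rceil>"
  have r: "m \<le> 2 ^ r" "2 ^ r < 2 * m"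
    using rounds_bound[OF m] by (simp_all add: r_def)
  have "i \<le> r \<Longrightarrow> \<exists>I :: 'v inst. construction_stage m r i I" for i
  proof (induction i)
    case 0
    show ?case by (rule exI) (rule construction_stage.base)
  next
    case (Suc i)
    then obtain I :: "'v inst" where I: "construction_stage m r i I" by auto
    define k where "k = m - 2 ^ (r - Suc i)"
    have "r - i = Suc (r - Suc i)" using Suc.prems by simp
    then have "2 * m - 2 ^ (r - i) = 2 * k" by (simp add: k_def algebra_simps)
    then have len: "length (I ! j) = 2 * k" if "j < length I" for j
      using construction_stage_lit_sat[OF I r] that by (simp add: lit_sat_def)
    have "infinite (UNIV - inst_vars I)"
      using inf by (simp add: inst_vars_def Diff_infinite_finite)
    then obtain f :: "nat \<Rightarrow> 'v" where f: "inj f" "range f \<subseteq> UNIV - inst_vars I"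
      using infinite_countable_subset by blast
    have "split_step m k I (concat (map (\<lambda>j. [replicate m (Pos (f j)) @ take k (I ! j),
        replicate m (Neg (f j)) @ drop k (I ! j)]) [0..<length I]))"
      unfolding split_step_def
      using f len
      by (intro exI[of _ f] exI[of _ "\<lambda>j. take k (I ! j)"] exI[of _ "\<lambda>j. drop k (I ! j)"])
        (auto intro: inj_on_subset simp flip: mset_append)
    then show ?case using construction_stage.step[OF I] Suc.prems unfolding k_def by auto
  qed
  then show ?thesis unfolding constructed_instance_def r_def Let_def by blast
qed

end

theory Submission
  imports Defs "HOL-Combinatorics.Permutations"
begin

text \<open>
  Let \<open>n\<close> be the number of clauses and \<open>q = 2m - 1\<close> their common length. A clause together with
  one of its two extra vertices is a clique with \<open>2m\<close> vertices, so everything about \<open>G\<close> except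
  its maximum degree follows from two properties of the instance: its independence graph has a
  proper colouring with \<open>2m\<close> colours, and it is unsatisfiable.

  \<^emph>\<open>Chromatic and clique number.\<close> In a colouring of the independence graph with \<open>2m\<close> colours
  each clause misses a colour, which its two extra vertices, not being adjacent to each other, can
  both take. Hence \<open>2m \<le> \<omega>(G) \<le> \<chi>(G) \<le> 2m\<close>.

  \<^emph>\<open>Vertex stability.\<close> Lowering \<open>\<omega>\<close> means hitting all the cliques above. Those of
  different clauses are disjoint, so this takes at least \<open>n\<close> vertices. Conversely \<open>n\<close> vertices suffice even
  to lower \<open>\<chi>\<close>: delete a whole colour class of the \<open>2m\<close>-colouring, which contains at most one
  occurrence from each clause, and one arbitrary occurrence from each clause it misses. Then one
  colour is no longer used, and each clause is left with \<open>2m - 2\<close> occurrences, so that one of the other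
  \<open>2m - 1\<close> colours is still free for its extra vertices.

  \<^emph>\<open>Independent vertex stability.\<close> If a hitting set has exactly \<open>n\<close> vertices, then it has exactly
  one in each clause together with its two extra vertices, and this one must be a literal
  occurrence, as it lies in both cliques of the clause. If the set is moreover independent, then the chosen
  literals never contradict each other and satisfy the instance. So unsatisfiability forces
  \<open>ivs\<^sub>\<omega> > n\<close>. These three points are combined in \<open>vs_of_colorable_unsat_instance\<close>.

  \<^emph>\<open>The construction.\<close> Unsatisfiability is inherited at each step, since one of the two literals of the
  new variable fails and leaves one half of the old clause to be satisfied. The colouring
  is inherited as well (\<open>split_colored_clause\<close>): if the halves of a clause \<open>x\<close> use the disjoint colour
  sets \<open>A\<close> and \<open>B\<close>, both of size at most \<open>m\<close>, cut the palette into two sets \<open>X \<supseteq> B\<close> and \<open>Y \<supseteq> A\<close> of size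
  \<open>m\<close> and use \<open>X\<close> for \<open>b\<^sub>x\<close> and \<open>Y\<close> for its negation; then \<open>X\<close> avoids \<open>A\<close>, \<open>Y\<close> avoids
  \<open>B\<close>, and no colour is shared by the two complementary literals.

  \<^emph>\<open>Maximum degree.\<close> A literal occurrence has \<open>2m - 2\<close> neighbours in its clause, two extra
  neighbours, and at most \<open>m\<close> complementary ones; for the variables of the last step there are
  exactly \<open>m\<close> of these, all outside the clause.
\<close>

section \<open>The augmented independence graph\<close>

lemma compl_compl [simp]: "compl (compl l) = l"
  by (cases l) auto

lemma compl_neq [simp]: "compl l \<noteq> l" "l \<noteq> compl l"
  by (cases l; simp)+

lemma mem_verts_indep_graph [simp]:
  "(i, j) \<in> verts (indep_graph I) \<longleftrightarrow> i < length I \<and> j < length (I ! i)"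
  by (simp add: indep_graph_def Let_def)

lemma mem_edges_indep_graph:
  "{u, v} \<in> edges (indep_graph I) \<longleftrightarrow>
     u \<in> verts (indep_graph I) \<and> v \<in> verts (indep_graph I) \<and> u \<noteq> v \<and>
     (fst u = fst v \<or> lit_at I u = compl (lit_at I v))"
  by (auto simp: indep_graph_def Let_def doubleton_eq_iff) metis+

lemma mem_verts_aug [simp]:
  "Occ u \<in> verts (aug_indep_graph I) \<longleftrightarrow> u \<in> verts (indep_graph I)"
  "Extra i s \<in> verts (aug_indep_graph I) \<longleftrightarrow> i < length I"
  by (auto simp: aug_indep_graph_def Let_def)

lemma Occ_image_doubleton: "{Occ u, Occ v} = Occ ` e \<longleftrightarrow> e = {u, v}"
proof -
  have "inj Occ" by (simp add: inj_def)
  then show ?thesis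
    by (metis image_empty image_insert inj_image_eq_iff)
qed

lemma mem_edges_aug [simp]:
  "{Occ u, Occ v} \<in> edges (aug_indep_graph I) \<longleftrightarrow> {u, v} \<in> edges (indep_graph I)"
  "{Occ u, Extra i s} \<in> edges (aug_indep_graph I) \<longleftrightarrow> u \<in> verts (indep_graph I) \<and> fst u = i"
  "{Extra i s, Occ u} \<in> edges (aug_indep_graph I) \<longleftrightarrow> u \<in> verts (indep_graph I) \<and> fst u = i"
  "{Extra i s, Extra i' s'} \<notin> edges (aug_indep_graph I)"
proof -
  show "{Occ u, Occ v} \<in> edges (aug_indep_graph I) \<longleftrightarrow> {u, v} \<in> edges (indep_graph I)"
    by (auto simp: aug_indep_graph_def Let_def doubleton_eq_iff image_iff Occ_image_doubleton)
  have "Extra i s \<notin> Occ ` e" for i s e by auto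
  then have x: "{Occ u, Extra i s} \<noteq> Occ ` e" "{Extra i s, Occ u} \<noteq> Occ ` e"
    "{Extra i s, Extra i' s'} \<noteq> Occ ` e" for u i s i' s' e
    by blast+
  show "{Occ u, Extra i s} \<in> edges (aug_indep_graph I) \<longleftrightarrow> u \<in> verts (indep_graph I) \<and> fst u = i"
    "{Extra i s, Occ u} \<in> edges (aug_indep_graph I) \<longleftrightarrow> u \<in> verts (indep_graph I) \<and> fst u = i"
    "{Extra i s, Extra i' s'} \<notin> edges (aug_indep_graph I)"
    unfolding aug_indep_graph_def Let_def by (cases u; auto simp: doubleton_eq_iff image_iff x)+
qed

section \<open>Degrees\<close>

lemma card_occurrences:
  "card {u \<in> verts (indep_graph I). lit_at I u = l} = count_list (concat I) l"
proof -
  have "{u \<in> verts (indep_graph I). lit_at I u = l} =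
      (SIGMA i:{..<length I}. {j. j < length (I ! i) \<and> l = I ! i ! j})"
    by (auto simp: lit_at_def)
  then have "card {u \<in> verts (indep_graph I). lit_at I u = l} =
      (\<Sum>i<length I. card {j. j < length (I ! i) \<and> l = I ! i ! j})"
    by (simp add: card_SigmaI)
  also have "\<dots> = (\<Sum>i<length I. count_list (I ! i) l)"
    by (simp add: count_list_eq_length_filter length_filter_conv_card)
  also have "\<dots> = count_list (concat I) l"
    using count_list_concat_map_upt[of "(!) I" "length I" l] by (simp add: map_nth)
  finally show ?thesis .
qed

lemma finite_verts_indep_graph: "finite (verts (indep_graph I))"
  using simple_graph_indep_graph[of I] by (simp add: simple_graph_def)

text \<open>
  The neighbours of an occurrence are the other \<open>q - 1\<close> in its clause, the at most \<open>p\<close>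
  occurrences of the complementary literal, and two extra vertices. An extra vertex has only \<open>q\<close> neighbours.
\<close>

lemma degree_aug_le:
  assumes sat: "lit_sat p q I" and v: "v \<in> verts (aug_indep_graph I)"
  shows "degree (aug_indep_graph I) v \<le> p + q + 1"
proof -
  let ?V = "verts (indep_graph I)"
  have len: "length (I ! i) = q" if "i < length I" for i
    using sat that by (simp add: lit_sat_def)
  let ?N = "{w \<in> verts (aug_indep_graph I). {v, w} \<in> edges (aug_indep_graph I)}"
  show ?thesis
  proof (cases v)
    case (Occ u)
    obtain i j where u: "u = (i, j)" "i < length I" "j < q"
      using v len unfolding Occ by (cases u) auto
    let ?A = "{i} \<times> ({..<q} - {j})"
    let ?B = "{w \<in> ?V. lit_at I w = compl (lit_at I u)}"
    have "w \<in> Occ ` (?A \<union> ?B) \<union> {Extra i True, Extra i False}" if "w \<in> ?N" for w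
      using that u len unfolding Occ
      by (cases w) (auto simp: mem_edges_indep_graph)
    then have "?N \<subseteq> Occ ` (?A \<union> ?B) \<union> {Extra i True, Extra i False}" by blast
    then have "card ?N \<le> card (Occ ` (?A \<union> ?B) \<union> {Extra i True, Extra i False})"
      by (rule card_mono[rotated]) (simp add: finite_verts_indep_graph)
    also have "\<dots> \<le> card (Occ ` (?A \<union> ?B)) + card {Extra i True, Extra i False}"
      by (rule card_Un_le)
    also have "\<dots> \<le> card (?A \<union> ?B) + 2"
      using card_image_le[of "?A \<union> ?B" Occ] by (simp add: finite_verts_indep_graph)
    also have "\<dots> \<le> card ?A + card ?B + 2"
      using card_Un_le[of ?A ?B] by simp
    also have "card ?B \<le> p"
      using sat by (simp add: card_occurrences lit_sat_def)
    also have "card ?A = q - 1"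
      using u by (simp add: card_cartesian_product)
    finally show ?thesis
      using u by (simp add: degree_def)
  next
    case (Extra i s)
    have "w \<in> Occ ` ({i} \<times> {..<q})" if "w \<in> ?N" for w
      using that len v unfolding Extra by (cases w) (auto simp: image_iff)
    then have "?N \<subseteq> Occ ` ({i} \<times> {..<q})" by blast
    then have "card ?N \<le> card (Occ ` ({i} \<times> {..<q}))"
      by (rule card_mono[rotated]) simp
    also have "\<dots> \<le> q"
      using card_image_le[of "{i} \<times> {..<q}" Occ] by (simp add: card_cartesian_product)
    finally show ?thesis by (simp add: degree_def)
  qed
qed

text \<open>
  Complementary occurrences inside the clause itself are already counted as clause mates, so the
  set \<open>A\<close> collects positions in a different clause.
\<close>

lemma degree_aug_ge:
  assumes i: "i < length I" "i' < length I" "i \<noteq> i'" and j: "j < length (I ! i)"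
    and A: "A \<subseteq> {..<length (I ! i')}" "\<And>k. k \<in> A \<Longrightarrow> I ! i' ! k = compl (I ! i ! j)"
  shows "length (I ! i) + card A + 1 \<le> degree (aug_indep_graph I) (Occ (i, j))"
proof -
  let ?N = "{w \<in> verts (aug_indep_graph I). {Occ (i, j), w} \<in> edges (aug_indep_graph I)}"
  let ?C = "{i} \<times> ({..<length (I ! i)} - {j})" and ?D = "{i'} \<times> A"
  have fin: "finite A" using A(1) finite_subset by blast
  have "card (Occ ` (?C \<union> ?D) \<union> {Extra i True, Extra i False}) = card (Occ ` (?C \<union> ?D)) + 2"
    using fin by (subst card_Un_disjoint) auto
  also have "card (Occ ` (?C \<union> ?D)) = card (?C \<union> ?D)"
    by (rule card_image) (simp add: inj_on_def)
  also have "\<dots> = (length (I ! i) - 1) + card A"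
    using fin i j by (subst card_Un_disjoint) (auto simp: card_cartesian_product)
  finally have "length (I ! i) + card A + 1 =
      card (Occ ` (?C \<union> ?D) \<union> {Extra i True, Extra i False})"
    using j by simp
  also have "\<dots> \<le> card ?N"
  proof (rule card_mono)
    show "finite ?N"
      using simple_graph_aug_indep_graph[of I] by (simp add: simple_graph_def)
    show "Occ ` (?C \<union> ?D) \<union> {Extra i True, Extra i False} \<subseteq> ?N"
      using i j A by (auto simp: mem_edges_indep_graph lit_at_def)
  qed
  finally show ?thesis by (simp add: degree_def)
qed

section \<open>Clause cliques\<close>

lemma card_clique_le_clique_number:
  assumes "simple_graph G" "K \<subseteq> verts G" "clique K (edges G)"
  shows "card K \<le> clique_number G"
  unfolding clique_number_def
  by (rule Max_ge[OF finite_clique_cards[OF assms(1)]]) (use assms in blast)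

definition clause_clique :: "'v inst \<Rightarrow> nat \<Rightarrow> bool \<Rightarrow> aug_vertex set" where
  "clause_clique I i s = insert (Extra i s) (Occ ` ({i} \<times> {..<length (I ! i)}))"

lemma clause_clique_clique:
  assumes "i < length I"
  shows "clause_clique I i s \<subseteq> verts (aug_indep_graph I)"
    and "clique (clause_clique I i s) (edges (aug_indep_graph I))"
  using assms by (auto simp: clause_clique_def clique_def mem_edges_indep_graph)

lemma card_clause_clique: "card (clause_clique I i s) = Suc (length (I ! i))"
proof -
  have "card (Occ ` ({i} \<times> {..<length (I ! i)})) = length (I ! i)"
    by (subst card_image) (auto simp: inj_on_def card_cartesian_product)
  then show ?thesis
    unfolding clause_clique_def by (subst card_insert_disjoint) auto
qed

lemma clause_clique_hit:
  assumes "i < length I"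
    and "clique_number (delete_verts (aug_indep_graph I) S) \<le> length (I ! i)"
  shows "S \<inter> clause_clique I i s \<noteq> {}"
proof
  assume disj: "S \<inter> clause_clique I i s = {}"
  let ?H = "delete_verts (aug_indep_graph I) S"
  have "clause_clique I i s \<subseteq> verts ?H" "clique (clause_clique I i s) (edges ?H)"
    using clause_clique_clique[OF assms(1), of s] disj
    by (auto simp: delete_verts_def clique_def)
  then have "card (clause_clique I i s) \<le> clique_number ?H"
    by (intro card_clique_le_clique_number simple_graph_delete_verts
        simple_graph_aug_indep_graph)
  then show False using assms(2) by (simp add: card_clause_clique)
qed

fun clause_of :: "aug_vertex \<Rightarrow> nat" where
  "clause_of (Occ u) = fst u"
| "clause_of (Extra i s) = i"

lemma clause_of_lt: "x \<in> verts (aug_indep_graph I) \<Longrightarrow> clause_of x < length I"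
  by (cases x) auto

lemma clause_of_clause_clique: "x \<in> clause_clique I i s \<Longrightarrow> clause_of x = i"
  by (auto simp: clause_clique_def)

text \<open>
  Mapping a vertex to its clause sends a hitting set \<open>S\<close> onto all clauses, which gives the bound.
  In the case of equality the map is injective on \<open>S\<close>, so \<open>S\<close> cannot hit the two cliques of a clause
  in their two different extra vertices.
\<close>

lemma clause_clique_transversal:
  assumes S: "S \<subseteq> verts (aug_indep_graph I)"
    and hit: "\<And>i s. i < length I \<Longrightarrow> S \<inter> clause_clique I i s \<noteq> {}"
  shows "length I \<le> card S"
    and "card S = length I \<Longrightarrow> i < length I \<Longrightarrow> \<exists>j<length (I ! i). Occ (i, j) \<in> S"
proof -
  have fin: "finite S"
    using S simple_graph_aug_indep_graph[of I] finite_subset by (auto simp: simple_graph_def)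
  have "i \<in> clause_of ` S" if i: "i < length I" for i
    using hit[OF i, of True] clause_of_clause_clique by (metis disjoint_iff image_eqI)
  then have img: "clause_of ` S = {..<length I}"
    using S clause_of_lt by fastforce
  then show "length I \<le> card S"
    using card_image_le[OF fin, of clause_of] by simp
  assume "card S = length I" and i: "i < length I"
  then have inj: "inj_on clause_of S"
    using img fin by (simp add: eq_card_imp_inj_on)
  show "\<exists>j<length (I ! i). Occ (i, j) \<in> S"
  proof (rule ccontr)
    assume "\<not> ?thesis"
    then have "Extra i True \<in> S" "Extra i False \<in> S"
      using hit[OF i, of True] hit[OF i, of False] by (auto simp: clause_clique_def)
    then show False using inj_onD[OF inj, of "Extra i True" "Extra i False"] by simp
  qed
qed

section \<open>Satisfiability and independent sets\<close>

text \<open>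
  A partial truth assignment is represented by the set \<open>L\<close> of literals it makes true, because
  such a set is what an independent set of occurrences directly provides.
\<close>

definition satisfiable :: "'v inst \<Rightarrow> bool" where
  "satisfiable I \<longleftrightarrow>
     (\<exists>L. (\<forall>l\<in>L. compl l \<notin> L) \<and> (\<forall>C\<in>set I. set C \<inter> L \<noteq> {}))"

lemma satisfiable_if_indep_transversal:
  assumes S: "S \<subseteq> verts (aug_indep_graph I)" "indep S (edges (aug_indep_graph I))"
    and hit: "\<And>i. i < length I \<Longrightarrow> \<exists>j<length (I ! i). Occ (i, j) \<in> S"
  shows "satisfiable I"
  unfolding satisfiable_def
proof (intro exI conjI ballI)
  let ?L = "{lit_at I u |u. Occ u \<in> S}"
  fix l assume "l \<in> ?L"
  then obtain u where u: "l = lit_at I u" "Occ u \<in> S" by blast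
  show "compl l \<notin> ?L"
  proof
    assume "compl l \<in> ?L"
    then obtain v where v: "compl l = lit_at I v" "Occ v \<in> S" by blast
    then have "u \<noteq> v" "lit_at I u = compl (lit_at I v)"
      using u(1) v(1) by (metis compl_compl compl_neq(1))+
    then have "{Occ u, Occ v} \<in> edges (aug_indep_graph I)"
      using S(1) u v by (auto simp: mem_edges_indep_graph)
    then show False
      using S(2) u(2) v(2) \<open>u \<noteq> v\<close> unfolding indep_def by blast
  qed
next
  let ?L = "{lit_at I u |u. Occ u \<in> S}"
  fix C assume "C \<in> set I"
  then obtain i where i: "i < length I" "C = I ! i" by (metis in_set_conv_nth)
  obtain j where j: "j < length (I ! i)" "Occ (i, j) \<in> S" using hit[OF i(1)] by blast
  have "I ! i ! j \<in> ?L" using j(2) by (auto simp: lit_at_def intro!: exI[of _ "(i, j)"])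
  moreover have "I ! i ! j \<in> set C" using i j(1) by simp
  ultimately show "set C \<inter> ?L \<noteq> {}" by blast
qed

section \<open>Colourings and vertex stability\<close>

lemma delete_verts_empty [simp]: "delete_verts H {} = H"
  by (simp add: delete_verts_def)

text \<open>
  A colouring of the independence graph minus \<open>S\<close> extends to the extra vertices as soon as every clause has fewer
  remaining occurrences than there are colours: the two extra vertices of a clause can share a free colour.
\<close>

lemma aug_coloring:
  assumes c: "proper_coloring (delete_verts (indep_graph I) S) k c"
    and few: "\<And>i. i < length I \<Longrightarrow> card ({i} \<times> {..<length (I ! i)} - S) < k"
  shows "\<exists>c'. proper_coloring (delete_verts (aug_indep_graph I) (Occ ` S)) k c'"
proof -
  have "\<exists>x<k. x \<notin> c ` ({i} \<times> {..<length (I ! i)} - S)" if "i < length I" for i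
  proof (rule ccontr)
    assume "\<not> ?thesis"
    then have "{..<k} \<subseteq> c ` ({i} \<times> {..<length (I ! i)} - S)" by blast
    then have "k \<le> card ({i} \<times> {..<length (I ! i)} - S)"
      using surj_card_le[of "{i} \<times> {..<length (I ! i)} - S" "{..<k}" c] by simp
    then show False using few[OF that] by simp
  qed
  then obtain e where e: "\<And>i. i < length I \<Longrightarrow> e i < k"
    "\<And>i. i < length I \<Longrightarrow> e i \<notin> c ` ({i} \<times> {..<length (I ! i)} - S)"
    by metis
  define c' where "c' = (\<lambda>x. case x of Occ u \<Rightarrow> c u | Extra i s \<Rightarrow> e i)"
  have "proper_coloring (delete_verts (aug_indep_graph I) (Occ ` S)) k c'"
    unfolding proper_coloring_def
  proof (intro conjI ballI impI)
    fix x assume "x \<in> verts (delete_verts (aug_indep_graph I) (Occ ` S))"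
    then show "c' x < k"
      using c e by (cases x) (auto simp: c'_def delete_verts_def proper_coloring_def image_iff)
  next
    fix x y assume "x \<in> verts (delete_verts (aug_indep_graph I) (Occ ` S))"
      "y \<in> verts (delete_verts (aug_indep_graph I) (Occ ` S))"
      "{x, y} \<in> edges (delete_verts (aug_indep_graph I) (Occ ` S))"
    then have xy: "x \<in> verts (aug_indep_graph I)" "x \<notin> Occ ` S"
      "y \<in> verts (aug_indep_graph I)" "y \<notin> Occ ` S" "{x, y} \<in> edges (aug_indep_graph I)"
      by (auto simp: delete_verts_def)
    have extra: "c u \<noteq> e (fst u)" if "Occ u \<in> verts (aug_indep_graph I)" "Occ u \<notin> Occ ` S" for u
      using e(2)[of "fst u"] that by (cases u) (force simp: image_iff)
    have occ: "c u \<noteq> c v" if "u \<notin> S" "v \<notin> S" "{u, v} \<in> edges (indep_graph I)" for u v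
      using c that by (auto simp: proper_coloring_def delete_verts_def mem_edges_indep_graph)
    show "c' x \<noteq> c' y"
    proof (cases x)
      case x: (Occ u)
      show ?thesis
      proof (cases y)
        case (Occ v)
        then show ?thesis using xy occ[of u v] x by (auto simp: c'_def)
      next
        case (Extra i s)
        then show ?thesis using xy extra[of u] x by (auto simp: c'_def)
      qed
    next
      case x: (Extra i s)
      show ?thesis
      proof (cases y)
        case (Occ v)
        then show ?thesis using xy extra[of v] x by (auto simp: c'_def)
      next
        case (Extra i' s')
        then show ?thesis using xy x by simp
      qed
    qed
  qed
  then show ?thesis by blast
qed

text \<open>
  This isolates what the theorem needs of the instance besides degrees. The colouring
  makes \<open>vs\<^sub>\<chi>\<close> as small as the disjoint clause cliques permit; unsatisfiability keeps an independent set
  from attaining the same size.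
\<close>

lemma vs_of_colorable_unsat_instance:
  assumes q: "q > 0" and len: "\<And>C. C \<in> set I \<Longrightarrow> length C = q"
    and c: "proper_coloring (indep_graph I) (Suc q) c"
    and unsat: "\<not> satisfiable I"
    and G: "G = aug_indep_graph I"
  shows "chromatic_number G = Suc q" and "clique_number G = Suc q"
    and "vs_chi G = length I" and "vs_omega G = length I"
    and "length I < ivs_omega G" and "ivs_omega G \<le> ivs_chi G"
proof -
  have simple: "simple_graph G" by (simp add: G simple_graph_aug_indep_graph)
  have simple': "simple_graph (delete_verts G S)" for S
    by (rule simple_graph_delete_verts[OF simple])
  have len': "length (I ! i) = q" if "i < length I" for i using len that by simp
  have I0: "0 < length I" using unsat by (auto simp: satisfiable_def)
  obtain c' where "proper_coloring G (Suc q) c'"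
    using aug_coloring[of I "{}" "Suc q" c] c len' by (auto simp: G card_cartesian_product)
  then have "chromatic_number G \<le> Suc q" by (rule chromatic_number_le)
  moreover have "Suc q \<le> clique_number G"
    using card_clique_le_clique_number[OF simple, of "clause_clique I 0 True"]
      clause_clique_clique[OF I0] I0 by (simp add: G card_clause_clique len')
  moreover have "clique_number G \<le> chromatic_number G"
    by (rule clique_number_le_chromatic_number[OF simple])
  ultimately show chi: "chromatic_number G = Suc q" and omega: "clique_number G = Suc q"
    by simp_all
  have omega_le: "clique_number (delete_verts G S) < clique_number G"
    if "chromatic_number (delete_verts G S) < chromatic_number G" for S
    using that clique_number_le_chromatic_number[OF simple', of S] chi omega by simp

  have hit: "S \<inter> clause_clique I i s \<noteq> {}"
    if "clique_number (delete_verts G S) < clique_number G" "i < length I" for S i s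
    using that omega clause_clique_hit[of i I S s] by (simp add: G len')
  have lower: "length I \<le> card S"
    if "S \<subseteq> verts G" "clique_number (delete_verts G S) < clique_number G" for S
    using clause_clique_transversal(1)[of S I] that hit by (simp add: G)

  obtain S where S: "S \<subseteq> verts G" "card S = length I"
    "chromatic_number (delete_verts G S) < chromatic_number G"
  proof -
    \<comment> \<open>\<open>p i\<close> is the occurrence in clause \<open>i\<close> with the top colour \<open>q\<close>, or the first one if that colour
      is absent; deleting all of them frees the colour \<open>q\<close>.\<close>
    define p where "p i = (i, if \<exists>j<q. c (i, j) = q then SOME j. j < q \<and> c (i, j) = q else 0)" for i
    have p: "fst (p i) = i" "snd (p i) < q" "j < q \<Longrightarrow> c (i, j) = q \<Longrightarrow> c (p i) = q" for i j
      using q someI_ex[of "\<lambda>j. j < q \<and> c (i, j) = q"] by (auto simp: p_def)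
    define T where "T = p ` {..<length I}"
    have T: "T \<subseteq> verts (indep_graph I)"
      using p len' unfolding T_def by (metis image_subsetI lessThan_iff mem_verts_indep_graph prod.collapse)
    have "proper_coloring (delete_verts (indep_graph I) T) q c"
      unfolding proper_coloring_def
    proof (intro conjI ballI impI)
      fix u assume "u \<in> verts (delete_verts (indep_graph I) T)"
      then have u: "u \<in> verts (indep_graph I)" "u \<notin> T" by (auto simp: delete_verts_def)
      obtain i j where ij: "u = (i, j)" "i < length I" "j < q"
        using u(1) len' by (cases u) auto
      have "c u \<noteq> q"
      proof
        assume cq: "c u = q"
        then have "c (p i) = q" using p ij by blast
        moreover have "p i \<in> T" using ij by (simp add: T_def)
        then have "p i \<noteq> u" "p i \<in> verts (indep_graph I)" using u T by auto
        then have "{u, p i} \<in> edges (indep_graph I)"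
          using u ij p(1)[of i] by (simp add: mem_edges_indep_graph)
        ultimately show False
          using c cq u \<open>p i \<in> verts (indep_graph I)\<close> unfolding proper_coloring_def by metis
      qed
      moreover have "c u < Suc q" using c u by (simp add: proper_coloring_def)
      ultimately show "c u < q" by simp
    next
      fix u v assume "u \<in> verts (delete_verts (indep_graph I) T)"
        "v \<in> verts (delete_verts (indep_graph I) T)"
        "{u, v} \<in> edges (delete_verts (indep_graph I) T)"
      then show "c u \<noteq> c v" using c by (auto simp: proper_coloring_def delete_verts_def)
    qed
    moreover have "card ({i} \<times> {..<length (I ! i)} - T) < q" if i: "i < length I" for i
    proof -
      have "p i \<in> T" using i unfolding T_def by blast
      moreover have "p i \<in> {i} \<times> {..<q}"
        using p(1)[of i] p(2)[of i] by (cases "p i") simp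
      ultimately have "{i} \<times> {..<q} - T \<noteq> {i} \<times> {..<q}" by (metis DiffD2)
      then have "card ({i} \<times> {..<q} - T) < card ({i} \<times> {..<q})"
        by (intro psubset_card_mono psubsetI Diff_subset) simp_all
      then show ?thesis using len'[OF i] by (simp add: card_cartesian_product)
    qed
    ultimately obtain c' where "proper_coloring (delete_verts G (Occ ` T)) q c'"
      using aug_coloring[of I T q c] G by blast
    then have "chromatic_number (delete_verts G (Occ ` T)) < chromatic_number G"
      using chromatic_number_le chi by (metis less_Suc_eq_le)
    moreover have "inj_on p {..<length I}" using p(1) by (metis inj_onI)
    then have "card (Occ ` T) = length I"
      by (simp add: T_def card_image inj_on_def)
    moreover have "Occ ` T \<subseteq> verts G" using T by (auto simp: G)
    ultimately show thesis using that by blast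
  qed

  have "vs_chi G \<le> length I"
    unfolding vs_chi_def by (rule Least_le) (intro exI[of _ S] conjI S)
  moreover have "length I \<le> vs_omega G"
  proof -
    have "\<exists>s. \<exists>S \<subseteq> verts G. card S = s \<and> clique_number (delete_verts G S) < clique_number G"
      using S omega_le by blast
    from LeastI_ex[OF this, folded vs_omega_def] obtain S where "S \<subseteq> verts G" "card S = vs_omega G"
      "clique_number (delete_verts G S) < clique_number G"
      by (elim exE conjE) (rule that)
    then show ?thesis using lower by metis
  qed
  moreover have "vs_omega G \<le> vs_chi G"
  proof -
    have "\<exists>s. \<exists>S \<subseteq> verts G. card S = s \<and> chromatic_number (delete_verts G S) < chromatic_number G"
      using S by blast
    from LeastI_ex[OF this, folded vs_chi_def] obtain S where "S \<subseteq> verts G" "card S = vs_chi G"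
      "chromatic_number (delete_verts G S) < chromatic_number G"
      by (elim exE conjE) (rule that)
    then show ?thesis
      unfolding vs_omega_def by (intro Least_le exI[of _ S] conjI omega_le)
  qed
  ultimately show "vs_chi G = length I" and "vs_omega G = length I" by simp_all

  have "Extra 0 True \<in> verts G" using I0 by (simp add: G)
  then have ne: "verts G \<noteq> {}" by blast
  show "ivs_omega G \<le> ivs_chi G"
  proof -
    have "\<exists>s. \<exists>S \<subseteq> verts G. indep S (edges G) \<and> card S = s \<and>
        chromatic_number (delete_verts G S) < chromatic_number G"
      using ivs_chi_exists[OF simple ne] by blast
    from LeastI_ex[OF this, folded ivs_chi_def] obtain S where "S \<subseteq> verts G" "indep S (edges G)"
      "card S = ivs_chi G" "chromatic_number (delete_verts G S) < chromatic_number G"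
      by (elim exE conjE) (rule that)
    then show ?thesis
      unfolding ivs_omega_def by (intro Least_le exI[of _ S] conjI omega_le)
  qed
  show "length I < ivs_omega G"
  proof -
    have "\<exists>s. \<exists>S \<subseteq> verts G. indep S (edges G) \<and> card S = s \<and>
        clique_number (delete_verts G S) < clique_number G"
      using ivs_omega_exists[OF simple ne] chi omega by auto
    from LeastI_ex[OF this, folded ivs_omega_def] obtain S where S: "S \<subseteq> verts G" "indep S (edges G)"
      "card S = ivs_omega G" "clique_number (delete_verts G S) < clique_number G"
      by (elim exE conjE) (rule that)
    have "card S \<noteq> length I"
    proof
      assume "card S = length I"
      then have "\<exists>j<length (I ! i). Occ (i, j) \<in> S" if "i < length I" for i
        using clause_clique_transversal(2)[of S I i] S hit that by (simp add: G)
      then show False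
        using satisfiable_if_indep_transversal[of S I] S unsat by (simp add: G)
    qed
    then show ?thesis using lower[OF S(1,4)] S(3) by simp
  qed
qed

section \<open>Unsatisfiability of the construction\<close>

text \<open>
  A consistent \<open>L\<close> contains at most one of the two literals of the new variable, so in one of the two new
  clauses it has to hit the half of the old clause.
\<close>

lemma split_step_unsat:
  assumes "split_step m k I I'" and "\<not> satisfiable I"
  shows "\<not> satisfiable I'"
proof
  assume "satisfiable I'"
  then obtain L where L: "\<forall>l\<in>L. compl l \<notin> L" "\<forall>C\<in>set I'. set C \<inter> L \<noteq> {}"
    by (auto simp: satisfiable_def)
  obtain b g h where gh: "\<And>j. j < length I \<Longrightarrow> mset (g j) + mset (h j) = mset (I ! j)"
    and I': "I' = concat (map (\<lambda>j. [replicate m (Pos (b j)) @ g j,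
                                     replicate m (Neg (b j)) @ h j]) [0..<length I])"
    using assms(1) unfolding split_step_def by blast
  have "set C \<inter> L \<noteq> {}" if C: "C \<in> set I" for C
  proof -
    obtain j where j: "j < length I" "C = I ! j" using C by (metis in_set_conv_nth)
    have C_split: "set C = set (g j) \<union> set (h j)"
      using gh[OF j(1)] j(2) by (metis set_mset_mset set_mset_union)
    have "replicate m (Pos (b j)) @ g j \<in> set I'" "replicate m (Neg (b j)) @ h j \<in> set I'"
      using j(1) unfolding I' by (auto intro!: bexI[of _ j])
    then obtain l l' where l: "l \<in> L" "l \<in> set (replicate m (Pos (b j)) @ g j)"
      and l': "l' \<in> L" "l' \<in> set (replicate m (Neg (b j)) @ h j)"
      using L(2) by (meson disjoint_iff)
    have "l \<in> set (g j) \<or> l' \<in> set (h j)"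
    proof (rule ccontr)
      assume "\<not> ?thesis"
      then have "l = Pos (b j)" "l' = compl l" using l(2) l'(2) by (auto split: if_splits)
      then show False using L(1) l(1) l'(1) by blast
    qed
    then show ?thesis using C_split l(1) l'(1) by blast
  qed
  then show False using assms(2) L(1) unfolding satisfiable_def by blast
qed

lemma construction_stage_unsat:
  "construction_stage m r i I \<Longrightarrow> \<not> satisfiable I"
proof (induction rule: construction_stage.induct)
  case (base a)
  show ?case
  proof
    assume "satisfiable [replicate (2 * m - 2 ^ r) (Pos a), replicate (2 * m - 2 ^ r) (Neg a)]"
    then obtain L where "\<forall>l\<in>L. compl l \<notin> L" "Pos a \<in> L" "Neg a \<in> L"
      by (auto simp: satisfiable_def split: if_splits)
    then show False by (metis compl.simps(1))
  qed
next
  case (step i I I')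
  then show ?case using split_step_unsat by blast
qed

lemma construction_stage_nonempty: "construction_stage m r i I \<Longrightarrow> I \<noteq> []"
  using construction_stage_unsat[of m r i I] by (auto simp: satisfiable_def)

section \<open>Colouring the construction\<close>

text \<open>
  A proper colouring of the independence graph, with each literal carrying its colour along.
  Positions in clauses do not appear, because a step of the construction permutes the literals of a clause.
\<close>

definition colored_instance :: "nat \<Rightarrow> ('v literal \<times> nat) list list \<Rightarrow> bool" where
  "colored_instance k J \<longleftrightarrow>
     (\<forall>C\<in>set J. distinct (map snd C) \<and> snd ` set C \<subseteq> {..<k}) \<and>
     (\<forall>l x. (l, x) \<in> set (concat J) \<longrightarrow> (compl l, x) \<notin> set (concat J))"

lemma proper_coloring_if_colored_instance:
  assumes "colored_instance k J" and I: "map (map fst) J = I"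
  shows "\<exists>c. proper_coloring (indep_graph I) k c"
proof -
  define c where "c = (\<lambda>(i, j). snd (J ! i ! j))"
  have col: "distinct (map snd C)" "snd ` set C \<subseteq> {..<k}" if "C \<in> set J" for C
    using assms that by (auto simp: colored_instance_def)
  have clash: "(compl l, x) \<notin> set (concat J)" if "(l, x) \<in> set (concat J)" for l x
    using assms that unfolding colored_instance_def by blast
  have mem: "i < length J" "j < length (J ! i)"  "(lit_at I (i, j), c (i, j)) = J ! i ! j"
    "J ! i ! j \<in> set (concat J)" if "(i, j) \<in> verts (indep_graph I)" for i j
    using that unfolding I[symmetric] by (auto simp: lit_at_def c_def intro!: nth_mem bexI)
  have "proper_coloring (indep_graph I) k c"
    unfolding proper_coloring_def
  proof (intro conjI ballI impI)
    fix u assume "u \<in> verts (indep_graph I)"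
    then show "c u < k"
      using mem[of "fst u" "snd u"] col[of "J ! fst u"] by (cases u) (force simp: c_def)
  next
    fix u v assume uv: "u \<in> verts (indep_graph I)" "v \<in> verts (indep_graph I)"
      "{u, v} \<in> edges (indep_graph I)"
    obtain i j i' j' where ij: "u = (i, j)" "v = (i', j')" by (cases u, cases v)
    show "c u \<noteq> c v"
    proof (cases "i = i'")
      case True
      then have "j \<noteq> j'" using uv ij by (auto simp: mem_edges_indep_graph)
      then show ?thesis
        using True mem[of i j] mem[of i j'] col(1)[of "J ! i"] uv ij
        by (auto simp: c_def distinct_conv_nth)
    next
      case False
      then have "lit_at I v = compl (lit_at I u)" using uv ij by (auto simp: mem_edges_indep_graph)
      then show ?thesis
        using clash[of "lit_at I u" "c u"] mem[of i j] mem[of i' j'] uv ij by metis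
    qed
  qed
  then show ?thesis by blast
qed

text \<open>
  Splitting a clause splits its coloured version: this pulls a partition of the literals back to the
  literal-colour pairs.
\<close>

lemma mset_split_map:
  assumes "mset xs + mset ys = mset (map f zs)"
  obtains xs' ys' where "map f xs' = xs" "map f ys' = ys" "mset xs' + mset ys' = mset zs"
proof -
  have "mset (xs @ ys) = mset (map f zs)" using assms by simp
  then obtain p where p: "p permutes {..<length (map f zs)}" "permute_list p (map f zs) = xs @ ys"
    by (rule mset_eq_permutation)
  define ws where "ws = permute_list p zs"
  have "map f ws = xs @ ys" using p by (simp add: ws_def permute_list_map)
  moreover have "mset ws = mset zs" using p by (simp add: ws_def)
  ultimately show thesis
    using that[of "take (length xs) ws" "drop (length xs) ws"]
    by (simp add: take_map[symmetric] drop_map[symmetric] flip: mset_append)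
qed

text \<open>
  The colours \<open>A\<close> of \<open>g\<close> and \<open>B\<close> of \<open>h\<close> are disjoint and number at most \<open>m\<close> each. So there is an
  \<open>m\<close>-element set \<open>X\<close> between \<open>B\<close> and the complement of \<open>A\<close>, and its complement \<open>Y\<close> is an
  \<open>m\<close>-element set between \<open>A\<close> and the complement of \<open>B\<close>: colour \<open>Pos b\<close> with \<open>X\<close> and \<open>Neg b\<close>
  with \<open>Y\<close>.
\<close>

lemma split_colored_clause:
  assumes C: "distinct (map snd C)" "snd ` set C \<subseteq> {..<2 * m}"
    and gh: "mset g + mset h = mset (map fst C)" "length g \<le> m" "length h \<le> m"
  obtains P N X Y where "map fst P = replicate m (Pos b) @ g" "map fst N = replicate m (Neg b) @ h"
    "distinct (map snd P)" "snd ` set P \<subseteq> {..<2 * m}"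
    "distinct (map snd N)" "snd ` set N \<subseteq> {..<2 * m}"
    "set P \<subseteq> {Pos b} \<times> X \<union> set C" "set N \<subseteq> {Neg b} \<times> Y \<union> set C" "X \<inter> Y = {}"
proof -
  obtain g' h' where g': "map fst g' = g" and h': "map fst h' = h"
    and C': "mset g' + mset h' = mset C"
    using gh(1) by (rule mset_split_map)
  have setC: "set C = set g' \<union> set h'" using C' by (metis set_mset_mset set_mset_union)
  have "mset (map snd g' @ map snd h') = mset (map snd C)"
    using C' by (metis image_mset_union mset_append mset_map)
  then have dist: "distinct (map snd g' @ map snd h')"
    using C(1) by (metis mset_eq_imp_distinct_iff)
  define A where "A = snd ` set g'"
  define B where "B = snd ` set h'"
  have AB: "A \<inter> B = {}" "A \<subseteq> {..<2 * m}" "B \<subseteq> {..<2 * m}" "finite A" "finite B"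
    using dist C(2) by (auto simp: A_def B_def setC)
  have "card A \<le> m" "card B \<le> m"
    using gh(2,3) g' h' unfolding A_def B_def
    by (metis card_length dual_order.trans length_map set_map)+
  moreover have "card ({..<2 * m} - A) = 2 * m - card A"
    using AB by (simp add: card_Diff_subset)
  ultimately have "\<exists>X. B \<subseteq> X \<and> X \<subseteq> {..<2 * m} - A \<and> card X = m"
    using AB by (intro exists_subset_between) auto
  then obtain X where X: "B \<subseteq> X" "X \<subseteq> {..<2 * m} - A" "card X = m" by blast
  have "finite X" using X(2) finite_subset by blast
  define Y where "Y = {..<2 * m} - X"
  have Y: "card Y = m" "Y \<inter> B = {}" "finite Y" "Y \<subseteq> {..<2 * m}"
    using X \<open>finite X\<close> card_Diff_subset[of X "{..<2 * m}"] by (auto simp: Y_def)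
  define P where "P = map (Pair (Pos b)) (sorted_list_of_set X) @ g'"
  define N where "N = map (Pair (Neg b)) (sorted_list_of_set Y) @ h'"
  have rep: "map (\<lambda>x. l) (sorted_list_of_set Z) = replicate m l" if "card Z = m" for l :: "'a literal" and Z :: "nat set"
    using that by (metis length_sorted_list_of_set map_replicate_const)
  have snd_map: "map snd (map (Pair l) zs) = zs" for l :: "'a literal" and zs :: "nat list"
    by (simp add: comp_def)
  show thesis
  proof (rule that[of P N X Y])
    show "map fst P = replicate m (Pos b) @ g" "map fst N = replicate m (Neg b) @ h"
      using g' h' rep X Y by (simp_all add: P_def N_def comp_def)
    have sP: "map snd P = sorted_list_of_set X @ map snd g'"
      and sN: "map snd N = sorted_list_of_set Y @ map snd h'"
      unfolding P_def N_def map_append snd_map by simp_all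
    show "distinct (map snd P)" "distinct (map snd N)"
      using dist X Y \<open>finite X\<close> unfolding sP sN by (auto simp: A_def B_def)
    have "set (map snd P) = X \<union> A" "set (map snd N) = Y \<union> B"
      using \<open>finite X\<close> Y unfolding sP sN by (simp_all add: A_def B_def)
    then show "snd ` set P \<subseteq> {..<2 * m}" "snd ` set N \<subseteq> {..<2 * m}"
      using X Y AB by auto
    show "set P \<subseteq> {Pos b} \<times> X \<union> set C" "set N \<subseteq> {Neg b} \<times> Y \<union> set C" "X \<inter> Y = {}"
      using \<open>finite X\<close> Y by (auto simp: P_def N_def setC Y_def)
  qed
qed

text \<open>
  Old literals keep their colours. As the new variables are fresh and distinct, a clash could only occur between
  the two literals of one new variable, and those use disjoint colour sets.
\<close>

lemma split_step_colored:
  assumes "split_step m k I I'" and k: "k \<le> m"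
    and J: "colored_instance (2 * m) J" "map (map fst) J = I"
  shows "\<exists>J'. colored_instance (2 * m) J' \<and> map (map fst) J' = I'"
proof -
  define n where "n = length I"
  obtain b g h where b: "inj_on b {..<n}"
    and fresh: "\<And>j. j < n \<Longrightarrow> b j \<notin> inst_vars I"
    and gh: "\<And>j. j < n \<Longrightarrow> mset (g j) + mset (h j) = mset (I ! j)"
      "\<And>j. j < n \<Longrightarrow> length (g j) = k \<and> length (h j) = k"
    and I': "I' = concat (map (\<lambda>j. [replicate m (Pos (b j)) @ g j,
                                     replicate m (Neg (b j)) @ h j]) [0..<n])"
    using assms(1) unfolding split_step_def n_def by blast
  have Jn: "length J = n" using J(2) by (auto simp: n_def)
  define Q where "Q j P N X Y \<longleftrightarrow>
    map fst P = replicate m (Pos (b j)) @ g j \<and> map fst N = replicate m (Neg (b j)) @ h j \<and>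
    distinct (map snd P) \<and> snd ` set P \<subseteq> {..<2 * m} \<and>
    distinct (map snd N) \<and> snd ` set N \<subseteq> {..<2 * m} \<and>
    set P \<subseteq> {Pos (b j)} \<times> X \<union> set (J ! j) \<and> set N \<subseteq> {Neg (b j)} \<times> Y \<union> set (J ! j) \<and>
    X \<inter> Y = {}" for j P N X Y
  have "\<exists>P N X Y. Q j P N X Y" if j: "j < n" for j
  proof -
    have C: "distinct (map snd (J ! j))" "snd ` set (J ! j) \<subseteq> {..<2 * m}"
      using J(1) j Jn by (auto simp: colored_instance_def)
    have "mset (g j) + mset (h j) = mset (map fst (J ! j))"
      using gh(1)[OF j] J(2) j Jn by auto
    then show ?thesis
      using split_colored_clause[OF C, of "g j" "h j" "b j"] gh(2)[OF j] k
      unfolding Q_def by metis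
  qed
  then obtain P N X Y where Q: "\<And>j. j < n \<Longrightarrow> Q j (P j) (N j) (X j) (Y j)" by metis
  define J' where "J' = concat (map (\<lambda>j. [P j, N j]) [0..<n])"
  have "map (map fst) J' = I'"
    unfolding J'_def I' map_concat map_map comp_def
    by (rule arg_cong[of _ _ concat], rule map_cong) (use Q in \<open>auto simp: Q_def\<close>)
  moreover have "colored_instance (2 * m) J'"
    unfolding colored_instance_def
  proof (intro conjI ballI allI impI)
    fix C assume "C \<in> set J'"
    then obtain j where "j < n" "C = P j \<or> C = N j" by (auto simp: J'_def)
    then show "distinct (map snd C)" "snd ` set C \<subseteq> {..<2 * m}"
      using Q[of j] by (auto simp: Q_def)
  next
    let ?old = "set (concat J)"
    let ?new = "\<lambda>l x. \<exists>j<n. l = Pos (b j) \<and> x \<in> X j \<or> l = Neg (b j) \<and> x \<in> Y j"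
    have J'_cases: "(l, x) \<in> ?old \<or> ?new l x" if lx: "(l, x) \<in> set (concat J')" for l x
    proof -
      obtain j where j: "j < n" "(l, x) \<in> set (P j) \<or> (l, x) \<in> set (N j)"
        using lx by (auto simp: J'_def)
      moreover have "set (J ! j) \<subseteq> ?old"
        using nth_mem[of j J] j(1) Jn by (simp add: UN_upper)
      ultimately show ?thesis using Q[of j] unfolding Q_def by blast
    qed
    have old_var: "var l \<in> inst_vars I" if "(l, x) \<in> ?old" for l x
      using that unfolding J(2)[symmetric] inst_vars_def by force
    have var_compl: "var (compl l) = var l" for l :: "'a literal" by (cases l) auto
    have new_var: "\<exists>j<n. var l = b j" if "?new l x" for l x using that by auto
    fix l x assume lx: "(l, x) \<in> set (concat J')"
    show "(compl l, x) \<notin> set (concat J')"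
    proof
      assume clx: "(compl l, x) \<in> set (concat J')"
      consider "(l, x) \<in> ?old" "(compl l, x) \<in> ?old" | "(l, x) \<in> ?old" "?new (compl l) x"
        | "?new l x" "(compl l, x) \<in> ?old" | "?new l x" "?new (compl l) x"
        using J'_cases[OF lx] J'_cases[OF clx] by blast
      then show False
      proof cases
        case 1
        then show ?thesis using J(1) unfolding colored_instance_def by blast
      next
        case 2
        then show ?thesis using old_var new_var fresh var_compl by metis
      next
        case 3
        then show ?thesis using old_var new_var fresh var_compl by metis
      next
        case 4
        then obtain i j where ij: "i < n" "j < n"
          "l = Pos (b i) \<and> x \<in> X i \<or> l = Neg (b i) \<and> x \<in> Y i"
          "compl l = Pos (b j) \<and> x \<in> X j \<or> compl l = Neg (b j) \<and> x \<in> Y j"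
          by blast
        then have "b i = b j" by auto
        then have "i = j" using b ij by (auto simp: inj_on_def)
        then show ?thesis using ij Q[of i] by (auto simp: Q_def)
      qed
    qed
  qed
  ultimately show ?thesis by blast
qed

lemma construction_stage_colored:
  assumes "construction_stage m r i I" and r: "m \<le> 2 ^ r"
  shows "\<exists>J. colored_instance (2 * m) J \<and> map (map fst) J = I"
  using assms(1)
proof (induction rule: construction_stage.induct)
  case (base a)
  let ?k = "2 * m - 2 ^ r"
  let ?J = "[map (Pair (Pos a)) [0..<?k], map (Pair (Neg a)) [m..<m + ?k]]"
  \<comment> \<open>The colours below \<open>m\<close> serve \<open>Pos a\<close>, those from \<open>m\<close> on serve \<open>Neg a\<close>.\<close>
  have k: "?k \<le> m" using r by simp
  then have "colored_instance (2 * m) ?J"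
    by (auto simp: colored_instance_def comp_def)
  moreover have "map (map fst) ?J = [replicate ?k (Pos a), replicate ?k (Neg a)]"
    by (simp add: comp_def map_replicate_const)
  ultimately show ?case by (intro exI[of _ ?J] conjI)
next
  case (step i I I')
  then show ?case using split_step_colored[OF step.hyps(3) diff_le_self] by blast
qed

section \<open>The maximum degree and the theorem\<close>

text \<open>
  The first two clauses of the new instance contain \<open>m\<close> copies each of a new literal and of its complement,
  so the very first occurrence attains the upper bound.
\<close>

lemma max_degree_split_step:
  assumes "split_step m k I I'" "I \<noteq> []" and m: "m > 0" and sat: "lit_sat m q I'"
  shows "max_degree (aug_indep_graph I') = m + q + 1"
proof -
  let ?G = "aug_indep_graph I'"
  have fin: "finite (verts ?G)"
    using simple_graph_aug_indep_graph[of I'] by (simp add: simple_graph_def)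
  obtain b g h where I': "I' = concat (map (\<lambda>j. [replicate m (Pos (b j)) @ g j,
                                     replicate m (Neg (b j)) @ h j]) [0..<length I])"
    using assms(1) unfolding split_step_def by blast
  obtain Is where Is: "I' = (replicate m (Pos (b 0)) @ g 0) # (replicate m (Neg (b 0)) @ h 0) # Is"
    using assms(2) unfolding I' by (subst (asm) upt_conv_Cons) auto
  have "length (I' ! 0) = q" using sat Is by (simp add: lit_sat_def)
  moreover have "length (I' ! 0) + card {..<m} + 1 \<le> degree ?G (Occ (0, 0))"
    using m by (intro degree_aug_ge[of 0 I' 1]) (auto simp: Is nth_append)
  ultimately have "m + q + 1 \<le> degree ?G (Occ (0, 0))" by simp
  moreover have v: "Occ (0, 0) \<in> verts ?G" using m by (simp add: Is)
  ultimately have "m + q + 1 = degree ?G (Occ (0, 0))"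
    using degree_aug_le[OF sat v] by simp
  then have "m + q + 1 \<in> degree ?G ` verts ?G"
    using v by (rule image_eqI)
  then show ?thesis
    unfolding max_degree_def using fin degree_aug_le[OF sat] by (intro Max_eqI) auto
qed

theorem proposition15:
  fixes m :: nat and I :: "'v inst" and G :: "aug_vertex ugraph"
  assumes "m \<ge> 2"
    and "constructed_instance m I"
    and "G = aug_indep_graph I"
  shows "max_degree G = 3 * m \<and>
         chromatic_number G = 2 * m \<and> clique_number G = 2 * m \<and>
         vs_chi G = vs_omega G \<and> vs_omega G < ivs_omega G \<and> ivs_omega G \<le> ivs_chi G"
proof -
  define r where "r = nat \<lceil>log 2 (real m)\<rceil>"
  have stage: "construction_stage m r r I"
    using assms(2) by (simp add: constructed_instance_def r_def Let_def)
  have r: "m \<le> 2 ^ r" using rounds_bound(1)[OF assms(1)] by (simp add: r_def)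
  have sat: "lit_sat m (2 * m - 1) I" by (rule constructed_instance_lit_sat[OF assms(1,2)])
  have q: "Suc (2 * m - 1) = 2 * m" "2 * m - 1 > 0" using assms(1) by auto
  obtain J where "colored_instance (2 * m) J" "map (map fst) J = I"
    using construction_stage_colored[OF stage r] by blast
  then obtain c where "proper_coloring (indep_graph I) (Suc (2 * m - 1)) c"
    using proper_coloring_if_colored_instance q by metis
  note main = vs_of_colorable_unsat_instance[OF q(2) _ this construction_stage_unsat[OF stage] assms(3)]
  \<comment> \<open>At least one step is made, so the degree lemma for a step applies.\<close>
  have "r \<noteq> 0" using r assms(1) by (intro notI) simp
  from stage have "max_degree G = 3 * m"
  proof cases
    case base
    then show ?thesis using \<open>r \<noteq> 0\<close> by simp
  next
    case (step i I0)
    then show ?thesis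
      using max_degree_split_step[OF _ construction_stage_nonempty _ sat] assms(1,3) by fastforce
  qed
  then show ?thesis using main sat q by (simp add: lit_sat_def)
qed

end
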